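(* Let $d\in\{2,3\}$ and consider the leader–follower nonholonomic multi-agent system, graph, and moving target formation $\bm p^*(t)$ described in the context, with $n_l\ge 2$ leaders moving along $\bm p_i(t)=\bm p_i^*(t)=\bm p_i^*(0)+\bm v_c t$. Suppose that the desired formation $(\bar{\mathcal G},\bm p^* )$ is infinitesimally bearing rigid. Let every follower $i\in\mathcal V_f$ use the bearing-only control law $$u_i=\bm h_i^\top(k_1\bm r_i+\bm\xi_i),\qquad \dot{\bm\xi}_i=\bm h_i\bm h_i^\top\bm r_i-(\bm I_d-\bm h_i\bm h_i^\top)\bm\xi_i,\qquad \bm\omega_i=\bm h_i\times k_2(\bm r_i+\bm\xi_i),$$ with $\bm r_i=\sum_{j\in\mathcal N_i}(\bm g_{ij}-\bm g_{ij}^* )$ and constants $k_1,k_2>0$, so that the followers obey the closed-loop equations $$\dot{\bm p}_i=\bm h_i\bm h_i^\top(k_1\bm r_i+\bm\xi_i),\quad \dot{\bm\xi}_i=\bm h_i\bm h_i^\top\bm r_i-(\bm I_d-\bm h_i\bm h_i^\top)\bm\xi_i,\quad \dot{\bm h}_i=k_2(\bm I_d-\bm h_i\bm h_i^\top)(\bm r_i+\bm\xi_i).$$ Suppose that no collision between agents happens along the trajectory, i.e. $\bm p_i(t)\neq\bm p_j(t)$ for all $i\ne j$ and all $t\ge 0$. Then $\bm p(t)\to\bm p^*(t)$ globally and asymptotically, i.e. for all initial follower positions $\bm p_i(0)\in\mathbb R^d$, unit headings $\bm h_i(0)$ and auxiliary vectors $\bm\xi_i(0)\in\mathbb R^d$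 ($i\in\mathcal V_f$), one has $\|\bm p(t)-\bm p^*(t)\|\to 0$ as $t\to\infty$.
   Context: **Agents.** There are $n$ agents in $\mathbb R^d$, $d\in\{2,3\}$, with index set $\mathcal V=\{1,\dots,n\}$. Agent $i$ has position $\bm p_i\in\mathbb R^d$ and unit heading vector $\bm h_i\in\mathbb R^d$, with kinematics $\dot{\bm p}_i=\bm h_i u_i$, $\dot{\bm h}_i=\bm\omega_i\times\bm h_i$, where $u_i\in\mathbb R$ is the forward velocity and $\bm\omega_i$ the angular velocity. (With $\bm\omega_i=\bm h_i\times k_2\bm y$ this gives $\dot{\bm h}_i=k_2(\bm I_d-\bm h_i\bm h_i^\top)\bm y$; for $d=2$ the cross product is understood via embedding in $\mathbb R^3$, and the latter formula is what is meant.) Write $\bm p=(\bm p_1^\top,\dots,\bm p_n^\top)^\top\in\mathbb R^{dn}$. **Leaders and followers.** $\mathcal V_l=\{1,\dots,n_l\}$ is the set of leaders, $n_l\ge2$, and $\mathcal V_f=\mathcal V\setminus\mathcal V_l$ is the set of followers. **Graph.** $\mathcal G=(\mathcal V,\mathcal E)$ is an undirected sensing graph. The augmented graph $\bar{\mathcal G}=(\mathcal V,\bar{\mathcal E})$ is obtained by adding an edge between every two leaders. $\mathcal N_i$ is the set of neighbors of $i$ (for a follower it is the same in $\mathcal G$ and $\bar{\mathcal G}$). **Bearings.** For $\bm p_i\ne\bm p_j$, $\bm g_{ij}=(\bm p_j-\bm p_i)/\|\bm p_j-\bm p_i\|$, and $\bm P_{\bm g}=\bm I_d-\bm g\bm g^\top$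 for a unit vector $\bm g$. **Target formation.** $\bm v_c\in\mathbb R^d$ is a constant vector (the leaders' common velocity, $\bm v_c=u_c\bm h_c$ with $\bm h_c$ the leaders' common constant unit heading and $|u_c|=\|\bm v_c\|$). The moving target formation is $\bm p^*(t)=(\bm p_1^*(t)^\top,\dots,\bm p_n^*(t)^\top)^\top$ with $\bm p_i^*(t)=\bm p_i^*(0)+\bm v_c t$ for all $i\in\mathcal V$, where no two agents coincide in $\bm p^*$. The constant desired bearings are $\bm g_{ij}^*=(\bm p_j^*-\bm p_i^* )/\|\bm p_j^*-\bm p_i^*\|$, $(i,j)\in\bar{\mathcal E}$. Leaders satisfy $\bm p_i(t)=\bm p_i^*(t)$ and $\bm h_i=\bm h_c$ for all $t\ge0$. **Infinitesimal bearing rigidity.** The bearing Laplacian $\bm{\mathcal B}\in\mathbb R^{dn\times dn}$ of $(\bar{\mathcal G},\bm p^* )$ has $d\times d$ blocks $[\bm{\mathcal B}]_{ij}=-\bm P_{\bm g_{ij}^*}$ for $i\ne j$, $(i,j)\in\bar{\mathcal E}$; $[\bm{\mathcal B}]_{ii}=\sum_{k:(i,k)\in\bar{\mathcal E}}\bm P_{\bm g_{ik}^*}$; and zero otherwise. $(\bar{\mathcal G},\bm p^* )$ is infinitesimally bearing rigid iff $\mathrm{null}(\bm{\mathcal B})=\mathrm{span}(\bm 1_n\otimes\bm I_d,\bm p^* )$ (i.e. $\operatorname{rank}\bm{\mathcal B}=dn-d-1$): the only infinitesimal motions preserving the bearings are translations and scaling. *)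

theory Defs
  imports "HOL-Analysis.Analysis"
begin

(* Agents are the elements of a finite type 'n; a configuration of n agents in R^d is an element
   of (real^'d)^'n, whose norm is the Euclidean norm of the stacked vector in R^(dn).
   Undirected graphs on 'n are symmetric irreflexive sets of ordered pairs. *)

definition undirected_graph :: "('n \<times> 'n) set \<Rightarrow> bool" where
  "undirected_graph E \<longleftrightarrow> sym E \<and> irrefl E"

definition neighbours :: "('n \<times> 'n) set \<Rightarrow> 'n \<Rightarrow> 'n set" where
  "neighbours E i = {j. (i, j) \<in> E}"

definition augmented_graph :: "('n \<times> 'n) set \<Rightarrow> 'n set \<Rightarrow> ('n \<times> 'n) set" where
  "augmented_graph E L = E \<union> {(i, j). i \<in> L \<and> j \<in> L \<and> i \<noteq> j}"

definition bearing :: "real^'d^'n \<Rightarrow> 'n \<Rightarrow> 'n \<Rightarrow> real^'d" where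
  "bearing p i j = (p $ j - p $ i) /\<^sub>R norm (p $ j - p $ i)"

definition outer_square :: "real^'d \<Rightarrow> real^'d^'d" where
  "outer_square g = (\<chi> a b. g $ a * g $ b)"

definition orth_proj :: "real^'d \<Rightarrow> real^'d^'d" where
  "orth_proj g = mat 1 - outer_square g"

definition bearing_laplacian_block ::
    "('n::finite \<times> 'n) set \<Rightarrow> real^'d^'n \<Rightarrow> 'n \<Rightarrow> 'n \<Rightarrow> real^'d^'d" where
  "bearing_laplacian_block E p i j =
     (if i = j then (\<Sum>k\<in>neighbours E i. orth_proj (bearing p i k))
      else if (i, j) \<in> E then - orth_proj (bearing p i j)
      else 0)"

definition bearing_laplacian ::
    "('n::finite \<times> 'n) set \<Rightarrow> real^'d^'n \<Rightarrow> real^('n \<times> 'd::finite)^('n \<times> 'd)" where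
  "bearing_laplacian E p =
     (\<chi> r c. bearing_laplacian_block E p (fst r) (fst c) $ snd r $ snd c)"

definition stack :: "real^'d^'n \<Rightarrow> real^('n::finite \<times> 'd::finite)" where
  "stack x = (\<chi> r. x $ fst r $ snd r)"

(* The vectors stack (\<chi> i. axis a 1) are the columns of the Kronecker product of the
   all-ones vector with the identity matrix. *)
definition infinitesimally_bearing_rigid ::
    "('n::finite \<times> 'n) set \<Rightarrow> real^'d::finite^'n \<Rightarrow> bool" where
  "infinitesimally_bearing_rigid E p \<longleftrightarrow>
     {x. bearing_laplacian E p *v x = 0} =
     span (insert (stack p) (range (\<lambda>a::'d. stack (\<chi> i. axis a 1))))"

definition bearing_error ::
    "('n::finite \<times> 'n) set \<Rightarrow> real^'d^'n \<Rightarrow> real^'d^'n \<Rightarrow> 'n \<Rightarrow> real^'d" where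
  "bearing_error E q p i = (\<Sum>j\<in>neighbours E i. bearing p i j - bearing q i j)"

end

theory Submission
  imports Defs
begin

text \<open>Let \<open>r\<^sub>i\<close> be the bearing error of follower \<open>i\<close>. Minus \<open>r\<^sub>i\<close> is the gradient at \<open>p\<^sub>i\<close> of the convex
  potential \<open>\<Phi> = \<Sum> (\<parallel>p\<^sub>j - p\<^sub>i\<parallel> - g*\<^sub>i\<^sub>j \<bullet> (p\<^sub>j - p\<^sub>i))\<close>, summed over the edges. Bearing rigidity together
  with two fixed leaders makes \<open>\<Phi>\<close>, as a function of the tracking error \<open>e\<close>, vanish only at 0, and
  hence coercive. The function
  \<open>V = \<Phi> + \<Sum> (\<parallel>\<xi>\<^sub>i - v\<^sub>c\<parallel>\<^sup>2 / 2 + (\<parallel>v\<^sub>c\<parallel> - v\<^sub>c \<bullet> h\<^sub>i) / k\<^sub>2)\<close> decreases at the rate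
  \<open>\<Sum> (k\<^sub>1 (h\<^sub>i \<bullet> r\<^sub>i)\<^sup>2 + \<parallel>\<sigma>\<^sub>i\<parallel>\<^sup>2)\<close>, where \<open>\<sigma>\<^sub>i\<close> is the component of \<open>\<xi>\<^sub>i\<close> orthogonal to \<open>h\<^sub>i\<close>.

  Distances between agents may tend to 0 along a subsequence of times, where the bearings are
  discontinuous, so the invariance principle is not directly available. Instead, everything is
  averaged over long late time windows. Up to errors that are small in mean, \<open>\<xi>\<^sub>i - v\<^sub>c\<close> is
  constant and is the derivative of the bounded error \<open>e\<^sub>i\<close>; hence it tends to 0. Then \<open>\<Phi>\<close> is nearly
  constant too, and by convexity \<open>\<Phi> \<le> - \<Sum> r\<^sub>i \<bullet> e\<^sub>i\<close>, which up to small errors is minus the derivative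
  of the bounded function \<open>\<Sum> h\<^sub>i \<bullet> e\<^sub>i / k\<^sub>2\<close>; hence \<open>\<Phi>\<close> tends to 0, and so does \<open>e\<close>.\<close>

section \<open>Functions that are small in mean\<close>

text \<open>All averaging in time goes through this form of the mean value theorem: an estimate in
  mean becomes monotonicity of a suitable function, and no integral is formed.\<close>

lemma nondecreasing_on_halfline:
  fixes f :: "real \<Rightarrow> real"
  assumes "\<And>t. t \<ge> 0 \<Longrightarrow> (f has_real_derivative f' t) (at t within {0..})"
    and "\<And>t. a \<le> t \<Longrightarrow> t \<le> b \<Longrightarrow> f' t \<ge> 0"
    and "0 \<le> a" "a \<le> b"
  shows "f a \<le> f b"
proof (cases "a = b")
  case False
  with assms have "a < b" by simp
  have "(f has_derivative (*) (f' x)) (at x within {a..b})" if "a \<le> x" "x \<le> b" for x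
    using assms(1)[of x] that assms(3)
    by (auto simp: has_field_derivative_def intro: has_derivative_subset)
  from mvt_simple[OF \<open>a < b\<close> this] obtain x
    where "x \<in> {a<..<b}" "f b - f a = f' x * (b - a)" by auto
  then show ?thesis
    using assms(2)[of x] \<open>a < b\<close> by (smt (verit) greaterThanLessThan_iff mult_nonneg_nonneg)
qed simp

text \<open>With D the dissipation rate of a Lyapunov function, D is integrable on the half-line, so
  that \<open>b\<close> becomes arbitrarily small in mean over late windows of fixed length. No pointwise
  convergence of \<open>b\<close> is claimed: the bearings need not be uniformly continuous along the
  trajectory, which rules out Barbalat's lemma.\<close>
definition mean_small :: "(real \<Rightarrow> real) \<Rightarrow> (real \<Rightarrow> real) \<Rightarrow> bool" where
  "mean_small D b \<longleftrightarrow> (\<forall>\<eta>>0. \<exists>K\<ge>0. \<forall>\<^sub>F t in at_top. b t \<le> \<eta> + K * D t)"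

lemma mean_small_add:
  assumes "mean_small D b" "mean_small D c"
  shows "mean_small D (\<lambda>t. b t + c t)"
  unfolding mean_small_def
proof (intro allI impI)
  fix \<eta> :: real assume "\<eta> > 0"
  then have "\<eta> / 2 > 0" by simp
  then obtain K K' where K: "K \<ge> 0" "\<forall>\<^sub>F t in at_top. b t \<le> \<eta> / 2 + K * D t"
    and K': "K' \<ge> 0" "\<forall>\<^sub>F t in at_top. c t \<le> \<eta> / 2 + K' * D t"
    using assms unfolding mean_small_def by metis
  have "\<forall>\<^sub>F t in at_top. b t + c t \<le> \<eta> + (K + K') * D t"
    using K(2) K'(2) by eventually_elim (simp add: algebra_simps)
  with K K' show "\<exists>K\<ge>0. \<forall>\<^sub>F t in at_top. b t + c t \<le> \<eta> + K * D t"
    by (intro exI[of _ "K + K'"]) auto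
qed

lemma mean_small_cmult:
  assumes "mean_small D b" "c \<ge> 0"
  shows "mean_small D (\<lambda>t. c * b t)"
  unfolding mean_small_def
proof (intro allI impI)
  fix \<eta> :: real assume "\<eta> > 0"
  \<comment> \<open>Dividing by \<open>c + 1\<close> instead of \<open>c\<close> covers
    \<open>c = 0\<close>.\<close>
  then have "\<eta> / (c + 1) > 0" using assms(2) by simp
  then obtain K where K: "K \<ge> 0" "\<forall>\<^sub>F t in at_top. b t \<le> \<eta> / (c + 1) + K * D t"
    using assms unfolding mean_small_def by metis
  have "c * (\<eta> / (c + 1)) \<le> \<eta>"
    using assms(2) \<open>\<eta> > 0\<close> by (simp add: field_simps)
  have "\<forall>\<^sub>F t in at_top. c * b t \<le> \<eta> + (c * K) * D t"
    using K(2)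
  proof eventually_elim
    case (elim t)
    from mult_left_mono[OF this assms(2)] \<open>c * (\<eta> / (c + 1)) \<le> \<eta>\<close> show ?case
      by (simp add: distrib_left mult.assoc)
  qed
  with K assms show "\<exists>K\<ge>0. \<forall>\<^sub>F t in at_top. c * b t \<le> \<eta> + K * D t"
    by (intro exI[of _ "c * K"]) auto
qed

lemma tendsto_0_imp_mean_small:
  assumes "(b \<longlongrightarrow> 0) at_top"
  shows "mean_small D b"
  unfolding mean_small_def
proof (intro allI impI)
  fix \<eta> :: real assume "\<eta> > 0"
  with assms have "\<forall>\<^sub>F t in at_top. b t < \<eta>" by (rule order_tendstoD)
  then show "\<exists>K\<ge>0. \<forall>\<^sub>F t in at_top. b t \<le> \<eta> + K * D t"
    by (intro exI[of _ 0]) (auto elim: eventually_mono)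
qed

lemma mean_small_sum:
  assumes "\<And>i. i \<in> I \<Longrightarrow> mean_small D (b i)"
  shows "mean_small D (\<lambda>t. \<Sum>i\<in>I. b i t)"
  using assms
proof (induction I rule: infinite_finite_induct)
  case (insert i I)
  then show ?case by (simp add: mean_small_add)
qed (auto intro: tendsto_0_imp_mean_small)

text \<open>Young's inequality \<open>b \<le> \<eta> + b^2 / (4 * \<eta>)\<close> trades quadratic
  control by the dissipation for linear control. The constant blows up as \<open>\<eta>\<close>
  tends to 0, which \<open>mean_small\<close> allows.\<close>

lemma square_le_imp_mean_small:
  assumes "c > 0" "\<forall>\<^sub>F t in at_top. c * (b t)\<^sup>2 \<le> D t"
  shows "mean_small D b"
  unfolding mean_small_def
proof (intro allI impI)
  fix \<eta> :: real assume "\<eta> > 0"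
  have "\<forall>\<^sub>F t in at_top. b t \<le> \<eta> + (1 / (4 * \<eta> * c)) * D t"
    using assms(2)
  proof eventually_elim
    case (elim t)
    have "0 \<le> (b t - 2 * \<eta>)\<^sup>2" by simp
    then have "4 * \<eta> * b t \<le> 4 * \<eta>\<^sup>2 + (b t)\<^sup>2"
      using \<open>\<eta> > 0\<close> by (simp add: power2_eq_square algebra_simps)
    then have "b t \<le> \<eta> + (b t)\<^sup>2 / (4 * \<eta>)"
      using \<open>\<eta> > 0\<close> by (simp add: field_simps power2_eq_square)
    also have "(b t)\<^sup>2 / (4 * \<eta>) = (1 / (4 * \<eta> * c)) * (c * (b t)\<^sup>2)"
      using assms(1) by simp
    also have "\<dots> \<le> (1 / (4 * \<eta> * c)) * D t"
      using elim assms(1) \<open>\<eta> > 0\<close> by (intro mult_left_mono) auto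
    finally show ?case by simp
  qed
  then show "\<exists>K\<ge>0. \<forall>\<^sub>F t in at_top. b t \<le> \<eta> + K * D t"
    using assms(1) \<open>\<eta> > 0\<close> by (intro exI[of _ "1 / (4 * \<eta> * c)"]) auto
qed

text \<open>If \<open>y\<close> were large at a late time T, it would stay large on the window from T to T + S,
  because it decreases little in mean; then \<open>g\<close> would drop by about \<open>S * y T\<close>, contradicting its
  boundedness when S is large.\<close>
lemma eventually_le_of_bounded_primitive:
  fixes V D y y' g g' b :: "real \<Rightarrow> real"
  assumes V: "\<And>t. t \<ge> 0 \<Longrightarrow> (V has_real_derivative - D t) (at t within {0..})"
    and D: "\<And>t. t \<ge> 0 \<Longrightarrow> D t \<ge> 0"
    and V0: "\<And>t. t \<ge> 0 \<Longrightarrow> V t \<ge> 0"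
    and y: "\<And>t. t \<ge> 0 \<Longrightarrow> (y has_real_derivative y' t) (at t within {0..})"
    and g: "\<And>t. t \<ge> 0 \<Longrightarrow> (g has_real_derivative g' t) (at t within {0..})"
    and y': "\<And>t. t \<ge> 0 \<Longrightarrow> y' t \<ge> - b t"
    and g': "\<And>t. t \<ge> 0 \<Longrightarrow> g' t \<le> b t - y t"
    and M: "\<And>t. t \<ge> 0 \<Longrightarrow> \<bar>g t\<bar> \<le> M"
    and b: "mean_small D b"
    and "\<epsilon> > 0"
  shows "\<forall>\<^sub>F t in at_top. y t \<le> \<epsilon>"
proof -
  have "M \<ge> 0" using M[of 0] by simp
  \<comment> \<open>On a window of length \<open>S\<close> the change of \<open>g\<close>, at most
    \<open>2 * M\<close>, averages to at most \<open>\<epsilon> / 4\<close>; the summand 1 ensures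
    \<open>S \<ge> 1\<close>.\<close>
  define S where "S = 8 * M / \<epsilon> + 1"
  have S: "S \<ge> 1" "2 * M \<le> \<epsilon> / 4 * S"
    using \<open>M \<ge> 0\<close> \<open>\<epsilon> > 0\<close> by (auto simp: S_def field_simps)
  \<comment> \<open>Of this budget, \<open>\<eta> * S\<close> pays for the decrease of
    \<open>y\<close> over the window and one more \<open>\<eta>\<close> for the mean error in
    \<open>g'\<close>.\<close>
  obtain \<eta> where \<eta>: "\<eta> > 0" "\<eta> * (S + 1) = \<epsilon> / 4"
  proof
    show "\<epsilon> / 4 / (S + 1) > 0" using S \<open>\<epsilon> > 0\<close> by simp
    show "\<epsilon> / 4 / (S + 1) * (S + 1) = \<epsilon> / 4"
      using S by (intro nonzero_eq_divide_eq[THEN iffD1]) auto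
  qed
  obtain K where K: "K \<ge> 0" "\<forall>\<^sub>F t in at_top. b t \<le> \<eta> + K * D t"
    using b \<eta>(1) unfolding mean_small_def by blast
  obtain T1 where T1: "\<And>t. t \<ge> T1 \<Longrightarrow> b t \<le> \<eta> + K * D t"
    using K(2) by (auto simp: eventually_at_top_linorder)
  have decr: "V t \<le> V s" if "0 \<le> s" "s \<le> t" for s t
    using nondecreasing_on_halfline[of "\<lambda>t. - V t" D s t] that D
    by (simp add: DERIV_minus[OF V, simplified])
  define \<zeta> where "\<zeta> = \<epsilon> / (8 * (K + 1))"
  have \<zeta>: "\<zeta> > 0" "K * \<zeta> \<le> \<epsilon> / 8"
    using K \<open>\<epsilon> > 0\<close> by (auto simp: \<zeta>_def field_simps)
  \<comment> \<open>\<open>V\<close> decreases and is bounded below, so after some time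
    \<open>T2\<close> it drops by at most \<open>\<zeta>\<close> in total. This stands in for the
    integrability of \<open>D\<close>.\<close>
  have "bdd_below (V ` {0..})" using V0 by (auto intro!: bdd_belowI2[of _ 0])
  then have Inf: "(INF t\<in>{0..}. V t) \<le> V t" if "t \<ge> 0" for t
    using that by (auto intro!: cINF_lower)
  obtain T2 where T2: "T2 \<ge> 0" "V T2 < (INF t\<in>{0..}. V t) + \<zeta>"
    using cInf_lessD[of "V ` {0..}" "(INF t\<in>{0..}. V t) + \<zeta>"] \<zeta> by auto
  have small: "V s - V t \<le> \<zeta>" if "T2 \<le> s" "0 \<le> t" for s t
    using decr[of T2 s] Inf[of t] T2 that by linarith
  have "y T \<le> \<epsilon>" if "T \<ge> max T1 T2" for T
  proof -
    have T: "T \<ge> 0" "T \<ge> T1" "T \<ge> T2" using that T2 by auto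
    have low: "y t \<ge> y T - \<eta> * S - K * \<zeta>" if "T \<le> t" "t \<le> T + S" for t
    proof -
      \<comment> \<open>Monotone because \<open>y' \<ge> - b \<ge> - \<eta> - K * D\<close>, and
        \<open>- D\<close> is the derivative of \<open>V\<close>.\<close>
      have "y T + \<eta> * T - K * V T \<le> y t + \<eta> * t - K * V t"
      proof (rule nondecreasing_on_halfline
            [where f = "\<lambda>t. y t + \<eta> * t - K * V t" and f' = "\<lambda>t. y' t + \<eta> + K * D t"])
        fix s assume "T \<le> s" "s \<le> t"
        with y'[of s] T1[of s] T show "0 \<le> y' s + \<eta> + K * D s" by linarith
      next
        show "((\<lambda>t. y t + \<eta> * t - K * V t) has_real_derivative y' s + \<eta> + K * D s)
          (at s within {0..})" if "0 \<le> s" for s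
          by (rule derivative_eq_intros V[OF that] y[OF that] refl | simp)+
      qed (use T that in auto)
      moreover have "K * (V T - V t) \<le> K * \<zeta>"
        using small[of T t] T that K by (intro mult_left_mono) auto
      moreover have "\<eta> * (t - T) \<le> \<eta> * S"
        using that \<eta> by (intro mult_left_mono) auto
      ultimately show ?thesis by (simp add: algebra_simps)
    qed
    define m where "m = y T - \<eta> * S - K * \<zeta>"
    \<comment> \<open>Since \<open>y \<ge> m\<close> on the window,
      \<open>g' \<le> \<eta> + K * D - m\<close> there, so a large \<open>m\<close> would force
      \<open>g\<close> down by more than \<open>2 * M\<close>.\<close>
    have "- g T - m * T + \<eta> * T - K * V T
        \<le> - g (T + S) - m * (T + S) + \<eta> * (T + S) - K * V (T + S)"
    proof (rule nondecreasing_on_halfline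
          [where f = "\<lambda>t. - g t - m * t + \<eta> * t - K * V t" and f' = "\<lambda>t. - g' t - m + \<eta> + K * D t"])
      fix t assume "T \<le> t" "t \<le> T + S"
      with low[of t] g'[of t] T1[of t] T show "0 \<le> - g' t - m + \<eta> + K * D t"
        unfolding m_def by linarith
    next
      show "((\<lambda>t. - g t - m * t + \<eta> * t - K * V t) has_real_derivative - g' s - m + \<eta> + K * D s)
        (at s within {0..})" if "0 \<le> s" for s
        by (rule derivative_eq_intros V[OF that] g[OF that] refl | simp)+
    qed (use T S in auto)
    then have "m * S \<le> (g T - g (T + S)) + \<eta> * S + K * (V T - V (T + S))"
      by (simp add: algebra_simps)
    also have "\<dots> \<le> 2 * M + \<eta> * S + K * \<zeta>"
    proof -
      have "K * (V T - V (T + S)) \<le> K * \<zeta>"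
        using small[of T "T + S"] T S K by (intro mult_left_mono) auto
      then show ?thesis using M[of T] M[of "T + S"] T S by linarith
    qed
    also have "\<dots> \<le> (\<epsilon> / 4 + \<eta> + \<epsilon> / 8) * S"
    proof -
      have "\<epsilon> / 8 \<le> \<epsilon> / 8 * S" using S \<open>\<epsilon> > 0\<close> by simp
      then show ?thesis using S \<zeta> by (simp only: distrib_right)
    qed
    finally have "m \<le> \<epsilon> / 4 + \<eta> + \<epsilon> / 8" using S by simp
    then have "y T \<le> \<epsilon> / 2 + \<eta> * (S + 1)"
      using \<zeta> unfolding m_def by (simp only: distrib_left)
    then show ?thesis using \<eta> \<open>\<epsilon> > 0\<close> by linarith
  qed
  then show ?thesis unfolding eventually_at_top_linorder by blast
qed

section \<open>The bearing potential\<close>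

text \<open>As \<open>sgn 0 = 0\<close>, coinciding agents have bearing 0; antisymmetry and the
  bound by 1 then hold for all configurations.\<close>

lemma bearing_eq_sgn: "bearing p i j = sgn (p $ j - p $ i)"
  by (simp add: bearing_def sgn_div_norm)

lemma bearing_swap: "bearing p j i = - bearing p i j"
  by (metis bearing_eq_sgn minus_diff_eq sgn_minus)

lemma bearing_inner_self: "bearing p i j \<bullet> (p $ j - p $ i) = norm (p $ j - p $ i)"
  by (cases "p $ j = p $ i") (auto simp: bearing_def dot_square_norm power2_eq_square)

lemma outer_square_mult: "outer_square g *v x = (g \<bullet> x) *\<^sub>R g"
  by (simp add: outer_square_def matrix_vector_mult_def vec_eq_iff inner_vec_def
      sum_distrib_left sum_distrib_right mult_ac)

lemma orth_proj_mult: "orth_proj g *v x = x - (g \<bullet> x) *\<^sub>R g"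
  by (simp add: orth_proj_def matrix_vector_mult_diff_rdistrib outer_square_mult)

text \<open>A summand is the excess of a distance over the component along the target bearing; it is
  0 exactly when \<open>p $ j - p $ i\<close> is a nonnegative multiple of that bearing. The factor
  1/2 is there because a symmetric \<open>E\<close> holds both orientations of an edge.\<close>

definition bearing_potential ::
    "('n::finite \<times> 'n) set \<Rightarrow> real^'d^'n \<Rightarrow> real^'d^'n \<Rightarrow> real" where
  "bearing_potential E q p =
     (1 / 2) * (\<Sum>(i, j)\<in>E. norm (p $ j - p $ i) - bearing q i j \<bullet> (p $ j - p $ i))"

lemma norm_bearing_le: "norm (bearing p i j) \<le> 1"
  by (simp add: bearing_eq_sgn norm_sgn)

lemma bearing_potential_summand_nonneg: "0 \<le> norm x - bearing q i j \<bullet> x"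
proof -
  have "bearing q i j \<bullet> x \<le> norm (bearing q i j) * norm x" by (rule norm_cauchy_schwarz)
  also have "\<dots> \<le> 1 * norm x" by (intro mult_right_mono norm_bearing_le) simp
  finally show ?thesis by simp
qed

lemma bearing_potential_nonneg: "bearing_potential E q p \<ge> 0"
  unfolding bearing_potential_def
  by (intro mult_nonneg_nonneg sum_nonneg)
    (auto simp: bearing_potential_summand_nonneg simp del: diff_ge_0_iff_ge)

lemma continuous_on_bearing_potential: "continuous_on S (bearing_potential E q)"
  unfolding bearing_potential_def case_prod_unfold
  by (intro continuous_intros)

text \<open>Summation by parts on a graph: reversing all edges turns the terms at one endpoint into
  the negatives of those at the other, so both halves of the difference contribute equally.\<close>

lemma sum_edges_antisym:
  fixes D :: "'n::finite \<Rightarrow> 'n \<Rightarrow> 'a::real_inner"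
  assumes "sym E" and "\<And>i j. D j i = - D i j"
  shows "(1 / 2) * (\<Sum>(i, j)\<in>E. D i j \<bullet> (x j - x i))
       = - (\<Sum>i\<in>UNIV. (\<Sum>j\<in>neighbours E i. D i j) \<bullet> x i)"
proof -
  have neg: "- (D j i \<bullet> x j) = D i j \<bullet> x j" for i j
    by (simp only: assms(2)[of i j] inner_minus_left minus_minus)
  have swap: "(\<Sum>(i, j)\<in>E. D i j \<bullet> x j) = (\<Sum>(i, j)\<in>E. - (D i j \<bullet> x i))"
    by (rule sum.reindex_bij_witness[where i = prod.swap and j = prod.swap])
      (use \<open>sym E\<close> neg in \<open>auto dest: symD\<close>)
  have E: "Sigma UNIV (neighbours E) = E" by (auto simp: neighbours_def)
  have "(\<Sum>(i, j)\<in>E. D i j \<bullet> (x j - x i))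
      = (\<Sum>(i, j)\<in>E. D i j \<bullet> x j) - (\<Sum>(i, j)\<in>E. D i j \<bullet> x i)"
    by (simp add: inner_diff_right sum_subtractf case_prod_unfold)
  also have "\<dots> = - 2 * (\<Sum>(i, j)\<in>E. D i j \<bullet> x i)"
    unfolding swap by (simp add: case_prod_unfold sum_negf)
  also have "(\<Sum>(i, j)\<in>E. D i j \<bullet> x i) = (\<Sum>i\<in>UNIV. \<Sum>j\<in>neighbours E i. D i j \<bullet> x i)"
    by (simp add: sum.Sigma E)
  finally show ?thesis by (simp add: inner_sum_left)
qed

lemma sum_edges_bearing_error:
  assumes "sym E"
  shows "(1 / 2) * (\<Sum>(i, j)\<in>E. (bearing p i j - bearing q i j) \<bullet> (x j - x i))
       = - (\<Sum>i\<in>UNIV. bearing_error E q p i \<bullet> x i)"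
  unfolding bearing_error_def
proof (rule sum_edges_antisym[OF assms])
  show "bearing p j i - bearing q j i = - (bearing p i j - bearing q i j)" for i j
    unfolding bearing_swap[of p j i] bearing_swap[of q j i] by simp
qed

text \<open>This is the gradient inequality of the convex bearing potential at \<open>p\<close>, compared with its
  minimiser \<open>q\<close>.\<close>
lemma bearing_potential_le:
  assumes "sym E"
  shows "bearing_potential E q p \<le> - (\<Sum>i\<in>UNIV. bearing_error E q p i \<bullet> (p $ i - q $ i))"
proof -
  have "norm (p $ j - p $ i) - bearing q i j \<bullet> (p $ j - p $ i)
      \<le> (bearing p i j - bearing q i j) \<bullet> ((p $ j - q $ j) - (p $ i - q $ i))" for i j
  proof -
    have "(p $ j - q $ j) - (p $ i - q $ i) = (p $ j - p $ i) - (q $ j - q $ i)" by simp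
    then have "(bearing p i j - bearing q i j) \<bullet> ((p $ j - q $ j) - (p $ i - q $ i))
      = (bearing p i j - bearing q i j) \<bullet> ((p $ j - p $ i) - (q $ j - q $ i))"
      by (rule arg_cong)
    \<comment> \<open>The second bracket is the same excess with \<open>p\<close> and
      \<open>q\<close> exchanged, hence nonnegative.\<close>
    also have "\<dots> = norm (p $ j - p $ i) - bearing q i j \<bullet> (p $ j - p $ i)
        + (norm (q $ j - q $ i) - bearing p i j \<bullet> (q $ j - q $ i))"
      using bearing_inner_self[of p i j] bearing_inner_self[of q i j]
      unfolding inner_diff_left inner_diff_right by linarith
    finally show ?thesis
      using bearing_potential_summand_nonneg[of "q $ j - q $ i" p i j] by linarith
  qed
  then have "bearing_potential E q p
      \<le> (1 / 2) * (\<Sum>(i, j)\<in>E. (bearing p i j - bearing q i j) \<bullet> ((p $ j - q $ j) - (p $ i - q $ i)))"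
    unfolding bearing_potential_def by (intro mult_left_mono sum_mono) auto
  then show ?thesis
    using sum_edges_bearing_error[OF assms, of p q "\<lambda>i. p $ i - q $ i"] by linarith
qed

text \<open>Convexity along the ray from \<open>q\<close>, where the potential is 0: each summand is
  a norm plus a linear form. It carries a lower bound on a sphere to the outside of the
  sphere.\<close>

lemma bearing_potential_scale_le:
  assumes "0 \<le> s" "s \<le> 1"
  shows "bearing_potential E q (q + s *\<^sub>R e) \<le> s * bearing_potential E q (q + e)"
proof -
  have "norm ((q + s *\<^sub>R e) $ j - (q + s *\<^sub>R e) $ i)
          - bearing q i j \<bullet> ((q + s *\<^sub>R e) $ j - (q + s *\<^sub>R e) $ i)
      \<le> s * (norm ((q + e) $ j - (q + e) $ i) - bearing q i j \<bullet> ((q + e) $ j - (q + e) $ i))" for i j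
  proof -
    define z x where "z = q $ j - q $ i" and "x = (q + e) $ j - (q + e) $ i"
    have eq: "(q + s *\<^sub>R e) $ j - (q + s *\<^sub>R e) $ i = (1 - s) *\<^sub>R z + s *\<^sub>R x"
      by (simp add: z_def x_def algebra_simps)
    have "norm ((1 - s) *\<^sub>R z + s *\<^sub>R x) \<le> (1 - s) * norm z + s * norm x"
      using assms norm_triangle_ineq[of "(1 - s) *\<^sub>R z" "s *\<^sub>R x"] by simp
    moreover have "bearing q i j \<bullet> z = norm z"
      by (simp add: z_def bearing_inner_self)
    ultimately show ?thesis
      unfolding eq x_def[symmetric] by (simp add: inner_add_right algebra_simps)
  qed
  then have "(\<Sum>(i, j)\<in>E. norm ((q + s *\<^sub>R e) $ j - (q + s *\<^sub>R e) $ i)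
          - bearing q i j \<bullet> ((q + s *\<^sub>R e) $ j - (q + s *\<^sub>R e) $ i))
      \<le> s * (\<Sum>(i, j)\<in>E. norm ((q + e) $ j - (q + e) $ i)
          - bearing q i j \<bullet> ((q + e) $ j - (q + e) $ i))"
    unfolding sum_distrib_left by (intro sum_mono) auto
  then show ?thesis unfolding bearing_potential_def by simp
qed

section \<open>Rigidity and coercivity of the potential\<close>

lemma matrix_vector_mult_sum_left:
  fixes A :: "'k \<Rightarrow> real^'m^'l"
  shows "(\<Sum>k\<in>K. A k) *v x = (\<Sum>k\<in>K. A k *v x)"
  by (induction K rule: infinite_finite_induct) (auto simp: matrix_vector_mult_add_rdistrib)

lemma matrix_vector_mult_minus_left:
  fixes A :: "real^'m^'l"
  shows "(- A) *v x = - (A *v x)"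
  by (simp add: matrix_vector_mult_def vec_eq_iff sum_negf)

text \<open>The block matrix acts as a graph Laplacian with matrix weights, so
  \<open>stack e\<close> lies in its kernel once the projected difference vanishes on every
  edge.\<close>

lemma bearing_laplacian_mult_stack:
  assumes "irrefl E"
  shows "bearing_laplacian E q *v stack e
       = stack (\<chi> i. \<Sum>k\<in>neighbours E i. orth_proj (bearing q i k) *v (e $ i - e $ k))"
proof -
  have "(\<Sum>c\<in>UNIV. bearing_laplacian_block E q i (fst c) $ a $ snd c * e $ fst c $ snd c)
      = (\<Sum>k\<in>neighbours E i. orth_proj (bearing q i k) *v (e $ i - e $ k)) $ a" for i a
  proof -
    let ?N = "neighbours E i"
    have "(\<Sum>c\<in>UNIV. bearing_laplacian_block E q i (fst c) $ a $ snd c * e $ fst c $ snd c)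
      = (\<Sum>j\<in>UNIV. (bearing_laplacian_block E q i j *v e $ j) $ a)"
      by (simp add: matrix_vector_mult_def sum.cartesian_product case_prod_unfold)
    also have "\<dots> = (\<Sum>j\<in>UNIV. bearing_laplacian_block E q i j *v e $ j) $ a" by simp
    also have "(\<Sum>j\<in>UNIV. bearing_laplacian_block E q i j *v e $ j)
      = bearing_laplacian_block E q i i *v e $ i
        + (\<Sum>j\<in>UNIV - {i}. bearing_laplacian_block E q i j *v e $ j)"
      by (rule sum.remove) auto
    \<comment> \<open>Irreflexivity keeps all neighbours of \<open>i\<close> inside
      \<open>UNIV - {i}\<close>; the other blocks are 0.\<close>
    also have "(\<Sum>j\<in>UNIV - {i}. bearing_laplacian_block E q i j *v e $ j)
      = (\<Sum>j\<in>?N. - (orth_proj (bearing q i j) *v e $ j))"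
      by (rule sum.mono_neutral_cong_right)
        (use assms in \<open>auto simp: neighbours_def bearing_laplacian_block_def irrefl_def
           matrix_vector_mult_minus_left\<close>)
    also have "bearing_laplacian_block E q i i *v e $ i
      = (\<Sum>j\<in>?N. orth_proj (bearing q i j) *v e $ i)"
      by (simp add: bearing_laplacian_block_def matrix_vector_mult_sum_left)
    finally show ?thesis
      by (simp add: sum_subtractf sum_negf matrix_vector_mult_diff_distrib del: sum_component)
  qed
  then show ?thesis
    by (simp add: bearing_laplacian_def stack_def matrix_vector_mult_def vec_eq_iff)
qed

text \<open>Equality in Cauchy-Schwarz makes the actual difference a multiple of the target bearing,
  as the target difference is. So is \<open>e $ i - e $ j\<close>, and the projection kills
  it.\<close>

lemma orth_proj_bearing_eq_0_of_summand_eq_0: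
  assumes "q $ i \<noteq> q $ j"
    and "norm ((q + e) $ j - (q + e) $ i) - bearing q i j \<bullet> ((q + e) $ j - (q + e) $ i) = 0"
  shows "orth_proj (bearing q i j) *v (e $ i - e $ j) = 0"
proof -
  define g x z where "g = bearing q i j" and "x = (q + e) $ j - (q + e) $ i"
    and "z = q $ j - q $ i"
  have g: "norm g = 1" using assms(1) by (simp add: g_def bearing_eq_sgn norm_sgn)
  have "g \<bullet> x = norm g * norm x" using assms(2) g by (simp add: g_def x_def)
  then have "norm g *\<^sub>R x = norm x *\<^sub>R g" by (simp only: norm_cauchy_schwarz_eq)
  then have x: "x = norm x *\<^sub>R g" using g by simp
  have z: "z = norm z *\<^sub>R g" using assms(1) by (simp add: g_def z_def bearing_def)
  have "e $ i - e $ j = z - x" by (simp add: x_def z_def)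
  also have "\<dots> = (norm z - norm x) *\<^sub>R g"
    by (subst x, subst z) (simp add: scaleR_diff_left)
  finally show ?thesis
    using g by (simp add: orth_proj_mult g_def[symmetric] dot_square_norm)
qed

lemma span_stack_translations:
  assumes "x \<in> span (range (\<lambda>a::'d::finite. stack (\<chi> i::'n::finite. axis a 1)))"
  shows "\<exists>w. x = stack (\<chi> i. w)"
proof -
  have "span (range (\<lambda>a::'d. stack (\<chi> i::'n. axis a 1))) \<subseteq> range (\<lambda>w. stack (\<chi> i. w))"
  proof (rule span_minimal)
    have "linear (\<lambda>w::real^'d. stack (\<chi> i::'n. w))"
      by (rule linearI) (auto simp: stack_def vec_eq_iff)
    then show "subspace (range (\<lambda>w::real^'d. stack (\<chi> i::'n. w)))"
      by (rule linear_subspace_image) simp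
  qed auto
  with assms show ?thesis by blast
qed

text \<open>By rigidity the error combines a scaling and a translation, and two leaders without
  error exclude both.\<close>

lemma bearing_potential_eq_0_imp:
  fixes e q :: "real^'d::finite^'n::finite"
  assumes "irrefl E" "card L \<ge> 2" and q: "\<And>i j. i \<noteq> j \<Longrightarrow> q $ i \<noteq> q $ j"
    and rigid: "infinitesimally_bearing_rigid (augmented_graph E L) q"
    and e: "\<And>i. i \<in> L \<Longrightarrow> e $ i = 0"
    and zero: "bearing_potential E q (q + e) = 0"
  shows "e = 0"
proof -
  let ?f = "\<lambda>(i, j). norm ((q + e) $ j - (q + e) $ i)
    - bearing q i j \<bullet> ((q + e) $ j - (q + e) $ i)"
  have "sum ?f E = 0" using zero unfolding bearing_potential_def by simp
  moreover have "?f ij \<ge> 0" for ij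
    by (cases ij) (use bearing_potential_summand_nonneg in auto)
  ultimately have f0: "?f ij = 0" if "ij \<in> E" for ij
    using that sum_nonneg_eq_0_iff[of E ?f] by simp
  have "orth_proj (bearing q i k) *v (e $ i - e $ k) = 0"
    if "k \<in> neighbours (augmented_graph E L) i" for i k
  proof (cases "(i, k) \<in> E")
    case True
    with assms(1) have "i \<noteq> k" by (auto simp: irrefl_def)
    then show ?thesis
      using f0[OF True] q by (intro orth_proj_bearing_eq_0_of_summand_eq_0) auto
  next
    case False
    \<comment> \<open>This edge was added between leaders, whose errors are both 0.\<close>
    with that e show ?thesis by (auto simp: neighbours_def augmented_graph_def)
  qed
  moreover have "irrefl (augmented_graph E L)"
    using assms(1) by (auto simp: augmented_graph_def irrefl_def)
  ultimately have "bearing_laplacian (augmented_graph E L) q *v stack e = 0"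
    by (simp add: bearing_laplacian_mult_stack) (simp add: stack_def vec_eq_iff)
  then have "stack e \<in> span (insert (stack q) (range (\<lambda>a::'d. stack (\<chi> i. axis a 1))))"
    using rigid unfolding infinitesimally_bearing_rigid_def by blast
  then obtain c where "stack e - c *\<^sub>R stack q \<in> span (range (\<lambda>a::'d. stack (\<chi> i. axis a 1)))"
    by (auto simp: span_insert)
  then obtain w where w: "stack e - c *\<^sub>R stack q = stack (\<chi> i. w)"
    using span_stack_translations by blast
  have ew: "e $ i = c *\<^sub>R q $ i + w" for i
  proof -
    have "e $ i $ a - c * q $ i $ a = w $ a" for a
      using arg_cong[OF w, of "\<lambda>x. x $ (i, a)"] by (simp add: stack_def)
    then show ?thesis by (simp add: vec_eq_iff algebra_simps)
  qed
  obtain i j where ij: "i \<in> L" "j \<in> L" "i \<noteq> j"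
    using assms(2) by (metis card_le_Suc0_iff_eq finite numeral_2_eq_2 not_less_eq_eq)
  \<comment> \<open>The difference of two leaders cancels the translation, so their distinct targets
    force \<open>c = 0\<close>.\<close>
  have "c *\<^sub>R (q $ i - q $ j) = e $ i - e $ j" by (simp add: ew scaleR_diff_right)
  then have "c = 0" using e ij q[of i j] by simp
  with ew[of i] e[of i] ij have "w = 0" by simp
  with \<open>c = 0\<close> ew show ?thesis by (simp add: vec_eq_iff)
qed

text \<open>Compactness gives a positive minimum on the sphere of radius \<open>\<epsilon>\<close>,
  and convexity along rays extends it outwards with linear growth. Radius 1 yields boundedness of
  the error, arbitrary radii yield its convergence.\<close>

lemma bearing_potential_coercive:
  fixes q :: "real^'d::finite^'n::finite"
  assumes "irrefl E" "card L \<ge> 2" and q: "\<And>i j. i \<noteq> j \<Longrightarrow> q $ i \<noteq> q $ j"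
    and rigid: "infinitesimally_bearing_rigid (augmented_graph E L) q"
    and "\<epsilon> > 0"
  shows "\<exists>m>0. \<forall>e. (\<forall>i\<in>L. e $ i = 0) \<longrightarrow> \<epsilon> \<le> norm e
    \<longrightarrow> m * norm e \<le> bearing_potential E q (q + e)"
proof -
  define S where "S = sphere 0 \<epsilon> \<inter> {e::real^'d^'n. \<forall>i\<in>L. e $ i = 0}"
  have "closed {e::real^'d^'n. \<forall>i\<in>L. e $ i = 0}"
    unfolding Ball_def
    by (intro closed_Collect_all closed_Collect_imp closed_Collect_eq continuous_intros) auto
  then have "compact S" unfolding S_def by (intro compact_Int_closed compact_sphere)
  have "\<exists>m>0. \<forall>e\<in>S. m \<le> bearing_potential E q (q + e)"
  proof (cases "S = {}")
    case False
    have "continuous_on S (\<lambda>e. bearing_potential E q (q + e))"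
      by (rule continuous_on_compose2[OF continuous_on_bearing_potential[of UNIV]])
        (auto intro!: continuous_intros)
    with \<open>compact S\<close> False obtain e where
      e: "e \<in> S" "\<And>e'. e' \<in> S \<Longrightarrow> bearing_potential E q (q + e) \<le> bearing_potential E q (q + e')"
      by (metis continuous_attains_inf)
    have "bearing_potential E q (q + e) \<noteq> 0"
    proof
      assume "bearing_potential E q (q + e) = 0"
      then have "e = 0"
        using e(1) by (intro bearing_potential_eq_0_imp[OF assms(1,2) q rigid]) (auto simp: S_def)
      then show False using e(1) \<open>\<epsilon> > 0\<close> by (auto simp: S_def)
    qed
    then have "bearing_potential E q (q + e) > 0"
      using bearing_potential_nonneg[of E q "q + e"] by simp
    with e(2) show ?thesis by blast
  \<comment> \<open>Without followers \<open>S\<close> is empty, and any positive constant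
    serves.\<close>
  qed (auto intro: exI[of _ 1])
  then obtain m where m: "m > 0" "\<And>e. e \<in> S \<Longrightarrow> m \<le> bearing_potential E q (q + e)" by blast
  show ?thesis
  proof (intro exI[of _ "m / \<epsilon>"] conjI allI impI)
    show "m / \<epsilon> > 0" using m \<open>\<epsilon> > 0\<close> by simp
    fix e :: "real^'d^'n" assume e: "\<forall>i\<in>L. e $ i = 0" "\<epsilon> \<le> norm e"
    define s where "s = \<epsilon> / norm e"
    have s: "0 < s" "s \<le> 1" using e \<open>\<epsilon> > 0\<close> by (auto simp: s_def divide_simps)
    have "s *\<^sub>R e \<in> S" using e \<open>\<epsilon> > 0\<close> by (auto simp: S_def s_def)
    then have "m \<le> s * bearing_potential E q (q + e)"
      using m(2) bearing_potential_scale_le[of s E q e] s by fastforce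
    moreover have "norm e > 0" using e \<open>\<epsilon> > 0\<close> by linarith
    ultimately show "m / \<epsilon> * norm e \<le> bearing_potential E q (q + e)"
      using \<open>\<epsilon> > 0\<close> by (simp add: s_def field_simps)
  qed
qed

lemma norm_bearing_error_le:
  "norm (bearing_error E q (p :: real^'d^'n::finite) i) \<le> 2 * real CARD('n)"
proof -
  have "norm (bearing_error E q p i) \<le> real (card (neighbours E i)) * 2"
    unfolding bearing_error_def
  proof (rule sum_norm_bound)
    show "norm (bearing p i j - bearing q i j) \<le> 2" for j
      using norm_triangle_ineq4[of "bearing p i j" "bearing q i j"]
        norm_bearing_le[of p i j] norm_bearing_le[of q i j] by linarith
  qed
  also have "\<dots> \<le> 2 * real CARD('n)" by (simp add: card_mono)
  finally show ?thesis .
qed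

section \<open>Calculus for the closed loop\<close>

lemma has_real_derivative_inner:
  assumes "(f has_vector_derivative f') (at t within S)"
    and "(g has_vector_derivative g') (at t within S)"
  shows "((\<lambda>t. f t \<bullet> g t) has_real_derivative f t \<bullet> g' + f' \<bullet> g t) (at t within S)"
  unfolding has_real_derivative_iff_has_vector_derivative
  by (rule bounded_bilinear.has_vector_derivative[OF bounded_bilinear_inner assms])

lemma has_real_derivative_norm:
  fixes f :: "real \<Rightarrow> 'a::real_inner"
  assumes "(f has_vector_derivative f') (at t within S)" "f t \<noteq> 0"
  shows "((\<lambda>t. norm (f t)) has_real_derivative sgn (f t) \<bullet> f') (at t within S)"
proof -
  have "((\<lambda>t. norm (f t)) has_derivative (\<lambda>x. sgn (f t) \<bullet> (x *\<^sub>R f'))) (at t within S)"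
    using has_derivative_compose[OF assms(1)[unfolded has_vector_derivative_def]
        has_derivative_norm[OF assms(2)]] by (simp add: inner_commute)
  then show ?thesis
    by (simp add: has_field_derivative_def mult_commute_abs)
qed

text \<open>Gronwall's argument: where \<open>c \<le> C\<close>, the function
  \<open>w^2 * exp (- 2 * C * t)\<close> does not increase, and it starts at 0.\<close>

lemma linear_ode_zero:
  fixes w c :: "real \<Rightarrow> real"
  assumes "\<And>t. t \<ge> 0 \<Longrightarrow> (w has_real_derivative c t * w t) (at t within {0..})"
    and "w 0 = 0" "T \<ge> 0" and C: "\<And>t. 0 \<le> t \<Longrightarrow> t \<le> T \<Longrightarrow> c t \<le> C"
  shows "w T = 0"
proof -
  have "- ((w 0)\<^sup>2 * exp (- 2 * C * 0)) \<le> - ((w T)\<^sup>2 * exp (- 2 * C * T))"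
  proof (rule nondecreasing_on_halfline[where f = "\<lambda>t. - ((w t)\<^sup>2 * exp (- 2 * C * t))"
        and f' = "\<lambda>t. 2 * (w t)\<^sup>2 * exp (- 2 * C * t) * (C - c t)"])
    show "((\<lambda>t. - ((w t)\<^sup>2 * exp (- 2 * C * t))) has_real_derivative
        2 * (w t)\<^sup>2 * exp (- 2 * C * t) * (C - c t)) (at t within {0..})" if "t \<ge> 0" for t
      by (rule derivative_eq_intros assms(1)[OF that] refl)+
        (simp add: power2_eq_square algebra_simps)
  qed (use C \<open>T \<ge> 0\<close> in auto)
  then show ?thesis using \<open>w 0 = 0\<close> by (simp add: mult_le_0_iff)
qed

section \<open>The closed-loop system\<close>

text \<open>The moving target enters through its position \<open>q\<close> at time 0 and its
  velocity \<open>v\<close>: a common translation leaves all bearings unchanged.\<close>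

locale bearing_only_tracking =
  fixes E :: "('n::finite \<times> 'n) set"
    and L :: "'n set"
    and q :: "real^'d::finite^'n"
    and p h \<xi> :: "real \<Rightarrow> real^'d^'n"
    and v :: "real^'d"
    and k\<^sub>1 k\<^sub>2 :: real
  assumes graph: "undirected_graph E"
    and leaders: "card L \<ge> 2"
    and target_distinct: "\<And>i j. i \<noteq> j \<Longrightarrow> q $ i \<noteq> q $ j"
    and rigid: "infinitesimally_bearing_rigid (augmented_graph E L) q"
    and gains: "k\<^sub>1 > 0" "k\<^sub>2 > 0"
    and leader_position: "\<And>i t. i \<in> L \<Longrightarrow> t \<ge> 0 \<Longrightarrow> p t $ i = q $ i + t *\<^sub>R v"
    and unit_heading: "\<And>i. i \<notin> L \<Longrightarrow> norm (h 0 $ i) = 1"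
    and position_dynamics: "\<And>i t. i \<notin> L \<Longrightarrow> t \<ge> 0 \<Longrightarrow>
          ((\<lambda>s. p s $ i) has_vector_derivative
             outer_square (h t $ i) *v (k\<^sub>1 *\<^sub>R bearing_error E q (p t) i + \<xi> t $ i))
          (at t within {0..})"
    and auxiliary_dynamics: "\<And>i t. i \<notin> L \<Longrightarrow> t \<ge> 0 \<Longrightarrow>
          ((\<lambda>s. \<xi> s $ i) has_vector_derivative
             outer_square (h t $ i) *v bearing_error E q (p t) i
             - orth_proj (h t $ i) *v (\<xi> t $ i))
          (at t within {0..})"
    and heading_dynamics: "\<And>i t. i \<notin> L \<Longrightarrow> t \<ge> 0 \<Longrightarrow>
          ((\<lambda>s. h s $ i) has_vector_derivative
             k\<^sub>2 *\<^sub>R (orth_proj (h t $ i) *v (bearing_error E q (p t) i + \<xi> t $ i)))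
          (at t within {0..})"
    and no_collision: "\<And>i j t. i \<noteq> j \<Longrightarrow> t \<ge> 0 \<Longrightarrow> p t $ i \<noteq> p t $ j"
begin

definition r :: "real \<Rightarrow> 'n \<Rightarrow> real^'d" where
  "r t i = bearing_error E q (p t) i"

definition \<alpha> :: "real \<Rightarrow> 'n \<Rightarrow> real" where
  "\<alpha> t i = h t $ i \<bullet> r t i"

definition \<sigma> :: "real \<Rightarrow> 'n \<Rightarrow> real^'d" where
  "\<sigma> t i = orth_proj (h t $ i) *v (\<xi> t $ i)"

definition err :: "real \<Rightarrow> real^'d^'n" where
  "err t = (\<chi> i. p t $ i - (q $ i + t *\<^sub>R v))"

text \<open>The component of \<open>\<xi>\<close> along the heading is written as
  \<open>\<xi> - \<sigma>\<close>; this separates \<open>\<xi> - v\<close> from terms that the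
  dissipation controls.\<close>

definition err' :: "real \<Rightarrow> 'n \<Rightarrow> real^'d" where
  "err' t i = (if i \<in> L then 0 else (k\<^sub>1 * \<alpha> t i) *\<^sub>R h t $ i + (\<xi> t $ i - v) - \<sigma> t i)"

definition potential :: "real \<Rightarrow> real" where
  "potential t = bearing_potential E q (p t)"

text \<open>The heading term is nonnegative at unit headings. Its weight
  \<open>1 / k\<^sub>2\<close> undoes the gain of the heading dynamics, so that all contributions of
  \<open>v\<close> cancel in the derivative.\<close>

definition lyapunov :: "real \<Rightarrow> real" where
  "lyapunov t = potential t +
     (\<Sum>i\<in>-L. (\<xi> t $ i - v) \<bullet> (\<xi> t $ i - v) / 2 + (norm v - v \<bullet> h t $ i) / k\<^sub>2)"

definition dissipation :: "real \<Rightarrow> real" where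
  "dissipation t = (\<Sum>i\<in>-L. k\<^sub>1 * (\<alpha> t i)\<^sup>2 + (norm (\<sigma> t i))\<^sup>2)"

lemma sym: "sym E" and irrefl: "irrefl E"
  using graph by (auto simp: undirected_graph_def)

lemma sigma_eq: "\<sigma> t i = \<xi> t $ i - (h t $ i \<bullet> \<xi> t $ i) *\<^sub>R h t $ i"
  by (simp add: \<sigma>_def orth_proj_mult)

lemma norm_r_le: "norm (r t i) \<le> 2 * real CARD('n)"
  unfolding r_def by (rule norm_bearing_error_le)

lemma err_leader: "i \<in> L \<Longrightarrow> t \<ge> 0 \<Longrightarrow> err t $ i = 0"
  by (simp add: err_def leader_position)

lemma potential_eq_err: "potential t = bearing_potential E q (q + err t)"
  by (simp add: potential_def bearing_potential_def err_def)

lemma err_deriv: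
  assumes "t \<ge> 0"
  shows "((\<lambda>s. err s $ i) has_vector_derivative err' t i) (at t within {0..})"
proof (cases "i \<in> L")
  case True
  have "((\<lambda>s. 0) has_vector_derivative (0::real^'d)) (at t within {0..})" by simp
  then have "((\<lambda>s. err s $ i) has_vector_derivative 0) (at t within {0..})"
    by (rule has_vector_derivative_transform[rotated 2]) (use True assms in \<open>auto simp: err_leader\<close>)
  with True show ?thesis by (simp add: err'_def)
next
  case False
  have "((\<lambda>s. q $ i + s *\<^sub>R v) has_vector_derivative v) (at t within {0..})"
    unfolding has_vector_derivative_def by (auto intro!: derivative_eq_intros)
  from has_vector_derivative_diff[OF position_dynamics[OF False assms] this]
  have "((\<lambda>s. p s $ i - (q $ i + s *\<^sub>R v)) has_vector_derivative
     outer_square (h t $ i) *v (k\<^sub>1 *\<^sub>R bearing_error E q (p t) i + \<xi> t $ i) - v)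
     (at t within {0..})" .
  moreover have "outer_square (h t $ i) *v (k\<^sub>1 *\<^sub>R bearing_error E q (p t) i + \<xi> t $ i) - v
      = err' t i"
    using False
    by (simp add: err'_def outer_square_mult sigma_eq \<alpha>_def r_def inner_add_right scaleR_add_left)
  ultimately show ?thesis by (simp add: err_def)
qed

lemma aux_deriv:
  assumes "i \<notin> L" "t \<ge> 0"
  shows "((\<lambda>s. \<xi> s $ i - v) has_vector_derivative \<alpha> t i *\<^sub>R h t $ i - \<sigma> t i) (at t within {0..})"
  using has_vector_derivative_diff[OF auxiliary_dynamics[OF assms] has_vector_derivative_const[of v]]
  by (simp add: outer_square_mult \<alpha>_def r_def \<sigma>_def)

lemma heading_deriv_raw:
  assumes "i \<notin> L" "t \<ge> 0"
  shows "((\<lambda>s. h s $ i) has_vector_derivative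
    k\<^sub>2 *\<^sub>R ((r t i + \<xi> t $ i) - (h t $ i \<bullet> (r t i + \<xi> t $ i)) *\<^sub>R h t $ i)) (at t within {0..})"
  using heading_dynamics[OF assms] by (simp only: orth_proj_mult r_def)

lemma heading_deriv:
  assumes "i \<notin> L" "t \<ge> 0"
  shows "((\<lambda>s. h s $ i) has_vector_derivative
    k\<^sub>2 *\<^sub>R (r t i - \<alpha> t i *\<^sub>R h t $ i + \<sigma> t i)) (at t within {0..})"
proof -
  have "(r t i + \<xi> t $ i) - (h t $ i \<bullet> (r t i + \<xi> t $ i)) *\<^sub>R h t $ i
      = r t i - \<alpha> t i *\<^sub>R h t $ i + \<sigma> t i"
    by (simp add: sigma_eq \<alpha>_def inner_add_right scaleR_add_left)
  with heading_deriv_raw[OF assms] show ?thesis by simp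
qed

text \<open>\<open>orth_proj\<close> is a projection only at unit vectors, so the heading dynamics preserves
  the norm because \<open>h \<bullet> h - 1\<close> solves a homogeneous linear equation.\<close>
lemma norm_heading:
  assumes "i \<notin> L" "T \<ge> 0"
  shows "norm (h T $ i) = 1"
proof -
  define c where "c t = - 2 * k\<^sub>2 * (h t $ i \<bullet> (r t i + \<xi> t $ i))" for t
  define w where "w t = h t $ i \<bullet> h t $ i - 1" for t
  have "continuous_on {0..} (\<lambda>s. h s $ i)"
    by (rule continuous_on_vector_derivative) (use heading_deriv assms in auto)
  then have conth: "continuous_on {0..T} (\<lambda>s. h s $ i)"
    by (rule continuous_on_subset) auto
  have "continuous_on {0..} (\<lambda>s. \<xi> s $ i)"
    by (rule continuous_on_vector_derivative) (use auxiliary_dynamics assms in auto)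
  then have contxi: "continuous_on {0..T} (\<lambda>s. \<xi> s $ i)"
    by (rule continuous_on_subset) auto
  \<comment> \<open>A continuous majorant of \<open>c\<close>, with \<open>r\<close> replaced by its
    uniform bound; its maximum on \<open>{0..T}\<close> is the constant for the Gronwall
    argument.\<close>
  let ?f = "\<lambda>s. 2 * k\<^sub>2 * (norm (h s $ i) * (2 * real CARD('n) + norm (\<xi> s $ i)))"
  have "continuous_on {0..T} ?f" by (intro continuous_intros conth contxi)
  moreover have "{0..T} \<noteq> {}" using assms by simp
  ultimately obtain s where "\<forall>t\<in>{0..T}. ?f t \<le> ?f s"
    using continuous_attains_sup[OF compact_Icc, of 0 T ?f] by blast
  then have s: "?f t \<le> ?f s" if "0 \<le> t" "t \<le> T" for t using that by (simp only: atLeastAtMost_iff)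
  have "w T = 0"
  proof (rule linear_ode_zero[where w = w and c = c and T = T and C = "?f s"])
    show "(w has_real_derivative c t * w t) (at t within {0..})" if "0 \<le> t" for t
    proof -
      note d = heading_deriv_raw[OF assms(1) that]
      show ?thesis
        unfolding w_def
        by (rule DERIV_cong[OF DERIV_diff[OF has_real_derivative_inner[OF d d] DERIV_const]])
          (simp add: c_def inner_diff_left inner_diff_right inner_commute algebra_simps)
    qed
    show "w 0 = 0" using unit_heading[OF assms(1)] by (simp add: w_def dot_square_norm)
    show "c t \<le> ?f s" if "0 \<le> t" "t \<le> T" for t
    proof -
      have "- (h t $ i \<bullet> (r t i + \<xi> t $ i)) \<le> norm (h t $ i) * norm (r t i + \<xi> t $ i)"
        using Cauchy_Schwarz_ineq2[of "h t $ i" "r t i + \<xi> t $ i"] by linarith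
      also have "\<dots> \<le> norm (h t $ i) * (2 * real CARD('n) + norm (\<xi> t $ i))"
        by (intro mult_left_mono norm_triangle_le add_right_mono norm_r_le) simp
      finally have "2 * k\<^sub>2 * - (h t $ i \<bullet> (r t i + \<xi> t $ i)) \<le> ?f t"
        using gains by (intro mult_left_mono) auto
      then show ?thesis using s[OF that] by (simp add: c_def)
    qed
  qed (use assms in auto)
  then show ?thesis by (simp add: w_def norm_eq_1)
qed

section \<open>Lyapunov decrease and boundedness\<close>

lemma potential_deriv:
  assumes "t \<ge> 0"
  shows "(potential has_real_derivative - (\<Sum>i\<in>-L. r t i \<bullet> err' t i)) (at t within {0..})"
proof -
  \<comment> \<open>The common drift \<open>s *\<^sub>R v\<close> cancels in differences of
    positions.\<close>
  have p: "p s $ j - p s $ i = q $ j - q $ i + (err s $ j - err s $ i)" for s i j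
    by (simp add: err_def)
  have "((\<lambda>s. norm (p s $ j - p s $ i) - bearing q i j \<bullet> (p s $ j - p s $ i)) has_real_derivative
      (bearing (p t) i j - bearing q i j) \<bullet> (err' t j - err' t i)) (at t within {0..})"
    if "(i, j) \<in> E" for i j
  proof -
    have "((\<lambda>s. p s $ j - p s $ i) has_vector_derivative 0 + (err' t j - err' t i)) (at t within {0..})"
      unfolding p by (intro derivative_intros err_deriv assms)
    then have d: "((\<lambda>s. p s $ j - p s $ i) has_vector_derivative err' t j - err' t i)
        (at t within {0..})"
      by simp
    \<comment> \<open>The absence of collisions makes the distance differentiable.\<close>
    have "p t $ j - p t $ i \<noteq> 0"
      using that irrefl no_collision[of j i t] assms by (auto simp: irrefl_def)
    from DERIV_diff[OF has_real_derivative_norm[OF d this]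
        has_real_derivative_inner[OF has_vector_derivative_const[of "bearing q i j"] d]]
    show ?thesis by (simp add: bearing_eq_sgn inner_diff_left)
  qed
  then have "(potential has_real_derivative (1 / 2) *
      (\<Sum>(i, j)\<in>E. (bearing (p t) i j - bearing q i j) \<bullet> (err' t j - err' t i))) (at t within {0..})"
    unfolding potential_def bearing_potential_def case_prod_unfold
    by (intro DERIV_cmult DERIV_sum) auto
  then have "(potential has_real_derivative - (\<Sum>i\<in>UNIV. r t i \<bullet> err' t i)) (at t within {0..})"
    unfolding r_def using sum_edges_bearing_error[OF sym, of "p t" q "err' t"] by simp
  also have "(\<Sum>i\<in>UNIV. r t i \<bullet> err' t i) = (\<Sum>i\<in>-L. r t i \<bullet> err' t i)"
    by (rule sum.mono_neutral_right) (auto simp: err'_def)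
  finally show ?thesis .
qed

text \<open>The potential loses the sum of \<open>r \<bullet> err'\<close>, and the other terms of
  \<open>lyapunov\<close> regain it up to the dissipation.\<close>

lemma lyapunov_deriv:
  assumes "t \<ge> 0"
  shows "(lyapunov has_real_derivative - dissipation t) (at t within {0..})"
proof -
  have *: "((\<lambda>t. (\<xi> t $ i - v) \<bullet> (\<xi> t $ i - v) / 2 + (norm v - v \<bullet> h t $ i) / k\<^sub>2)
      has_real_derivative r t i \<bullet> err' t i - (k\<^sub>1 * (\<alpha> t i)\<^sup>2 + (norm (\<sigma> t i))\<^sup>2)) (at t within {0..})"
    if "i \<in> -L" for i
  proof -
    have i: "i \<notin> L" using that by simp
    let ?x = "\<xi> t $ i" and ?h = "h t $ i"
    have hh: "?h \<bullet> ?h = 1" using norm_heading[OF i assms] by (simp add: dot_square_norm)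
    have "((\<lambda>t. (\<xi> t $ i - v) \<bullet> (\<xi> t $ i - v) / 2 + (norm v - v \<bullet> h t $ i) / k\<^sub>2)
      has_real_derivative
        ((?x - v) \<bullet> (\<alpha> t i *\<^sub>R ?h - \<sigma> t i) + (\<alpha> t i *\<^sub>R ?h - \<sigma> t i) \<bullet> (?x - v)) / 2
        + (0 - (v \<bullet> (k\<^sub>2 *\<^sub>R (r t i - \<alpha> t i *\<^sub>R ?h + \<sigma> t i)) + 0 \<bullet> ?h)) / k\<^sub>2) (at t within {0..})"
      by (intro DERIV_add DERIV_cdivide DERIV_diff DERIV_const has_real_derivative_inner
          aux_deriv heading_deriv has_vector_derivative_const i assms)
    moreover have "((?x - v) \<bullet> (\<alpha> t i *\<^sub>R ?h - \<sigma> t i) + (\<alpha> t i *\<^sub>R ?h - \<sigma> t i) \<bullet> (?x - v)) / 2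
        + (0 - (v \<bullet> (k\<^sub>2 *\<^sub>R (r t i - \<alpha> t i *\<^sub>R ?h + \<sigma> t i)) + 0 \<bullet> ?h)) / k\<^sub>2
      = (?x - v) \<bullet> (\<alpha> t i *\<^sub>R ?h - \<sigma> t i) - v \<bullet> (r t i - \<alpha> t i *\<^sub>R ?h + \<sigma> t i)"
      using gains by (simp add: inner_commute)
    \<comment> \<open>With \<open>h \<bullet> h = 1\<close>, both sides are \<open>\<alpha> * (h
      \<bullet> \<xi>) - v \<bullet> r - (norm \<sigma>)^2\<close>.\<close>
    moreover have "\<dots> = r t i \<bullet> err' t i - (k\<^sub>1 * (\<alpha> t i)\<^sup>2 + (norm (\<sigma> t i))\<^sup>2)"
      using i unfolding power2_norm_eq_inner
      by (simp add: err'_def sigma_eq \<alpha>_def inner_diff_left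
          inner_diff_right inner_add_left inner_add_right hh power2_eq_square inner_commute
          algebra_simps)
    ultimately show ?thesis by simp
  qed
  have "(lyapunov has_real_derivative - (\<Sum>i\<in>-L. r t i \<bullet> err' t i)
      + (\<Sum>i\<in>-L. r t i \<bullet> err' t i - (k\<^sub>1 * (\<alpha> t i)\<^sup>2 + (norm (\<sigma> t i))\<^sup>2))) (at t within {0..})"
    unfolding lyapunov_def
    by (intro DERIV_add DERIV_sum * potential_deriv assms)
  then show ?thesis by (simp add: dissipation_def sum_subtractf)
qed

lemma dissipation_nonneg: "dissipation t \<ge> 0"
  unfolding dissipation_def using gains by (intro sum_nonneg add_nonneg_nonneg) auto

lemma potential_nonneg: "potential t \<ge> 0"
  unfolding potential_def by (rule bearing_potential_nonneg)

lemma potential_le_lyapunov: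
  assumes "t \<ge> 0"
  shows "potential t \<le> lyapunov t"
proof -
  have "v \<bullet> h t $ i \<le> norm v" if "i \<notin> L" for i
    using norm_cauchy_schwarz[of v "h t $ i"] norm_heading[OF that assms] by simp
  then show ?thesis
    unfolding lyapunov_def using gains
    by (auto intro!: sum_nonneg add_nonneg_nonneg divide_nonneg_pos)
qed

lemma lyapunov_nonneg: "t \<ge> 0 \<Longrightarrow> lyapunov t \<ge> 0"
  using potential_le_lyapunov[of t] potential_nonneg[of t] by linarith

lemma lyapunov_le_initial:
  assumes "t \<ge> 0"
  shows "lyapunov t \<le> lyapunov 0"
proof -
  have "- lyapunov 0 \<le> - lyapunov t"
    by (rule nondecreasing_on_halfline[where f = "\<lambda>t. - lyapunov t" and f' = dissipation])
      (use DERIV_minus[OF lyapunov_deriv] dissipation_nonneg assms in auto)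
  then show ?thesis by simp
qed

text \<open>The potential never exceeds \<open>lyapunov 0\<close>, while outside the unit ball it is
  at least a positive multiple of the norm of the error.\<close>

lemma err_bounded: "\<exists>M. \<forall>t\<ge>0. norm (err t) \<le> M"
proof -
  obtain m where m: "m > 0" "\<And>e. \<forall>i\<in>L. e $ i = 0 \<Longrightarrow> 1 \<le> norm e
      \<Longrightarrow> m * norm e \<le> bearing_potential E q (q + e)"
    using bearing_potential_coercive[OF irrefl leaders target_distinct rigid zero_less_one] by blast
  have "norm (err t) \<le> max 1 (lyapunov 0 / m)" if "t \<ge> 0" for t
  proof (cases "1 \<le> norm (err t)")
    case True
    have "m * norm (err t) \<le> lyapunov 0"
      using m(2)[OF _ True] err_leader[of _ t] potential_eq_err[of t] potential_le_lyapunov[of t]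
        lyapunov_le_initial[of t] that by simp
    then have "norm (err t) \<le> lyapunov 0 / m" using m(1) by (simp add: field_simps)
    then show ?thesis by simp
  qed simp
  then show ?thesis by blast
qed

section \<open>Convergence by averaging\<close>

lemma mean_small_alpha: "i \<notin> L \<Longrightarrow> mean_small dissipation (\<lambda>t. \<bar>\<alpha> t i\<bar>)"
  and mean_small_sigma: "i \<notin> L \<Longrightarrow> mean_small dissipation (\<lambda>t. norm (\<sigma> t i))"
proof -
  assume i: "i \<notin> L"
  have *: "k\<^sub>1 * (\<alpha> t i)\<^sup>2 + (norm (\<sigma> t i))\<^sup>2 \<le> dissipation t" for t
    unfolding dissipation_def using i gains
    by (intro member_le_sum[where f = "\<lambda>i. k\<^sub>1 * (\<alpha> t i)\<^sup>2 + (norm (\<sigma> t i))\<^sup>2"]) auto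
  have "k\<^sub>1 * \<bar>\<alpha> t i\<bar>\<^sup>2 \<le> dissipation t" for t
    using *[of t] zero_le_power2[of "norm (\<sigma> t i)"] unfolding power2_abs by linarith
  then show "mean_small dissipation (\<lambda>t. \<bar>\<alpha> t i\<bar>)"
    by (intro square_le_imp_mean_small[OF gains(1)] always_eventually allI)
  have "1 * (norm (\<sigma> t i))\<^sup>2 \<le> dissipation t" for t
    using *[of t] mult_nonneg_nonneg[of "k\<^sub>1" "(\<alpha> t i)\<^sup>2"] gains zero_le_power2[of "\<alpha> t i"] by linarith
  then show "mean_small dissipation (\<lambda>t. norm (\<sigma> t i))"
    by (intro square_le_imp_mean_small[OF zero_less_one] always_eventually allI)
qed

lemma inner_err'_le:
  assumes "i \<notin> L" "t \<ge> 0"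
  shows "\<bar>u \<bullet> (err' t i - (\<xi> t $ i - v))\<bar> \<le> norm u * (k\<^sub>1 * \<bar>\<alpha> t i\<bar> + norm (\<sigma> t i))"
proof -
  have "err' t i - (\<xi> t $ i - v) = (k\<^sub>1 * \<alpha> t i) *\<^sub>R h t $ i - \<sigma> t i"
    using assms by (simp add: err'_def)
  moreover have "norm ((k\<^sub>1 * \<alpha> t i) *\<^sub>R h t $ i - \<sigma> t i) \<le> k\<^sub>1 * \<bar>\<alpha> t i\<bar> + norm (\<sigma> t i)"
    using norm_triangle_ineq4[of "(k\<^sub>1 * \<alpha> t i) *\<^sub>R h t $ i" "\<sigma> t i"] norm_heading[OF assms] gains
    by (simp add: abs_mult)
  ultimately have "norm (err' t i - (\<xi> t $ i - v)) \<le> k\<^sub>1 * \<bar>\<alpha> t i\<bar> + norm (\<sigma> t i)" by simp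
  from order_trans[OF Cauchy_Schwarz_ineq2 mult_left_mono[OF this norm_ge_zero]]
  show ?thesis .
qed

text \<open>The averaging argument applies to \<open>y = u \<bullet> (\<xi> - v)\<close>: its
  derivative, and its distance from the derivative of the bounded \<open>u \<bullet> err\<close>,
  are small in mean. The estimate is one-sided, but \<open>u\<close> may be replaced by
  \<open>- u\<close>.\<close>

lemma inner_aux_le:
  assumes "i \<notin> L" "norm u \<le> 1"
  shows "\<forall>\<epsilon>>0. \<forall>\<^sub>F t in at_top. u \<bullet> (\<xi> t $ i - v) \<le> \<epsilon>"
proof (intro allI impI)
  fix \<epsilon> :: real assume "\<epsilon> > 0"
  obtain M where M: "\<And>t. t \<ge> 0 \<Longrightarrow> norm (err t) \<le> M" using err_bounded by blast
  show "\<forall>\<^sub>F t in at_top. u \<bullet> (\<xi> t $ i - v) \<le> \<epsilon>"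
  \<comment> \<open>One \<open>b\<close> has to serve both estimates: \<open>y'\<close> needs the
    factor 1, and \<open>g'\<close> at most \<open>k\<^sub>1 + 1\<close>. The zero inner products
    come from the product rule with the constant \<open>u\<close>.\<close>
  proof (rule eventually_le_of_bounded_primitive[OF lyapunov_deriv dissipation_nonneg lyapunov_nonneg,
        where b = "\<lambda>t. (k\<^sub>1 + 1) * (\<bar>\<alpha> t i\<bar> + norm (\<sigma> t i))"
        and y' = "\<lambda>t. u \<bullet> (\<alpha> t i *\<^sub>R h t $ i - \<sigma> t i) + 0 \<bullet> (\<xi> t $ i - v)"
        and g = "\<lambda>t. (- u) \<bullet> err t $ i" and g' = "\<lambda>t. (- u) \<bullet> err' t i + 0 \<bullet> err t $ i"
        and M = M])
    show "mean_small dissipation (\<lambda>t. (k\<^sub>1 + 1) * (\<bar>\<alpha> t i\<bar> + norm (\<sigma> t i)))"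
      using assms gains by (intro mean_small_cmult mean_small_add mean_small_alpha mean_small_sigma) auto
    fix t :: real assume t: "t \<ge> 0"
    show "((\<lambda>t. u \<bullet> (\<xi> t $ i - v)) has_real_derivative
        u \<bullet> (\<alpha> t i *\<^sub>R h t $ i - \<sigma> t i) + 0 \<bullet> (\<xi> t $ i - v)) (at t within {0..})"
      by (intro has_real_derivative_inner has_vector_derivative_const aux_deriv assms t)
    show "((\<lambda>t. (- u) \<bullet> err t $ i) has_real_derivative (- u) \<bullet> err' t i + 0 \<bullet> err t $ i)
        (at t within {0..})"
      by (intro has_real_derivative_inner has_vector_derivative_const err_deriv t)
    have "norm (\<alpha> t i *\<^sub>R h t $ i - \<sigma> t i) \<le> \<bar>\<alpha> t i\<bar> + norm (\<sigma> t i)"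
      using norm_triangle_ineq4[of "\<alpha> t i *\<^sub>R h t $ i" "\<sigma> t i"] norm_heading[OF assms(1) t] by simp
    moreover have u: "\<bar>u \<bullet> x\<bar> \<le> norm x" for x
      using Cauchy_Schwarz_ineq2[of u x] mult_right_mono[OF assms(2), of "norm x"] by simp
    moreover have k: "0 \<le> k\<^sub>1 * \<bar>\<alpha> t i\<bar>" "0 \<le> k\<^sub>1 * norm (\<sigma> t i)" using gains by auto
    ultimately show "- ((k\<^sub>1 + 1) * (\<bar>\<alpha> t i\<bar> + norm (\<sigma> t i)))
        \<le> u \<bullet> (\<alpha> t i *\<^sub>R h t $ i - \<sigma> t i) + 0 \<bullet> (\<xi> t $ i - v)"
      using u[of "\<alpha> t i *\<^sub>R h t $ i - \<sigma> t i"]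
      unfolding distrib_right distrib_left inner_zero_left by linarith
    have "\<bar>u \<bullet> (err' t i - (\<xi> t $ i - v))\<bar> \<le> k\<^sub>1 * \<bar>\<alpha> t i\<bar> + norm (\<sigma> t i)"
      using inner_err'_le[OF assms(1) t, of u] gains
        mult_right_mono[OF assms(2), of "k\<^sub>1 * \<bar>\<alpha> t i\<bar> + norm (\<sigma> t i)"] by simp
    then show "(- u) \<bullet> err' t i + 0 \<bullet> err t $ i
        \<le> (k\<^sub>1 + 1) * (\<bar>\<alpha> t i\<bar> + norm (\<sigma> t i)) - u \<bullet> (\<xi> t $ i - v)"
      using k unfolding inner_diff_right[of u "err' t i"] inner_minus_left inner_zero_left
        distrib_right distrib_left by linarith
    show "\<bar>(- u) \<bullet> err t $ i\<bar> \<le> M"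
      using u[of "err t $ i"] Finite_Cartesian_Product.norm_nth_le[of "err t" i] M[OF t]
      unfolding inner_minus_left abs_minus_cancel by linarith
  qed (use \<open>\<epsilon> > 0\<close> in auto)
qed

lemma aux_tendsto:
  assumes "i \<notin> L"
  shows "((\<lambda>t. norm (\<xi> t $ i - v)) \<longlongrightarrow> 0) at_top"
proof (rule tendsto_norm_zero, rule vec_tendstoI)
  fix a
  show "((\<lambda>t. (\<xi> t $ i - v) $ a) \<longlongrightarrow> 0 $ a) at_top"
  proof (rule tendstoI)
    fix \<epsilon> :: real assume "\<epsilon> > 0"
    then have "\<epsilon> / 2 > 0" by simp
    \<comment> \<open>Opposite unit vectors bound a coordinate from both sides.\<close>
    have "\<forall>\<^sub>F t in at_top. axis a 1 \<bullet> (\<xi> t $ i - v) \<le> \<epsilon> / 2"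
      "\<forall>\<^sub>F t in at_top. (- axis a 1) \<bullet> (\<xi> t $ i - v) \<le> \<epsilon> / 2"
      using inner_aux_le[OF assms, of "axis a 1", rule_format, OF _ \<open>\<epsilon> / 2 > 0\<close>]
        inner_aux_le[OF assms, of "- axis a 1", rule_format, OF _ \<open>\<epsilon> / 2 > 0\<close>]
      by (simp_all only: norm_minus_cancel norm_axis_1 order_refl)
    then show "\<forall>\<^sub>F t in at_top. dist ((\<xi> t $ i - v) $ a) (0 $ a) < \<epsilon>"
      by eventually_elim (use \<open>\<epsilon> > 0\<close> in \<open>simp add: inner_axis' dist_real_def abs_less_iff\<close>)
  qed
qed

text \<open>In the derivative of the bounded sum of \<open>h \<bullet> err / k\<^sub>2\<close>, the
  turning of the heading produces \<open>r \<bullet> err\<close>, whose sum is at most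
  \<open>- potential\<close> by convexity. The remainders are small in mean because
  \<open>\<xi> - v\<close> is now known to tend to 0.\<close>

lemma potential_eventually_le:
  assumes "\<epsilon> > 0"
  shows "\<forall>\<^sub>F t in at_top. potential t \<le> \<epsilon>"
proof -
  obtain M where M: "\<And>t. t \<ge> 0 \<Longrightarrow> norm (err t) \<le> M" using err_bounded by blast
  have Mi: "norm (err t $ i) \<le> M" if "t \<ge> 0" for t i
    using M[OF that] Finite_Cartesian_Product.norm_nth_le[of "err t" i] by linarith
  have "M \<ge> 0" using M[of 0] norm_ge_zero[of "err 0"] by linarith
  define R where "R = 2 * real CARD('n)"
  define \<beta> where "\<beta> t i = \<bar>\<alpha> t i\<bar> + norm (\<sigma> t i) + norm (\<xi> t $ i - v)" for t i
  \<comment> \<open>The first two summands bound the remainder in \<open>g'\<close>, the last one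
    the derivative of the potential.\<close>
  define C where "C = M + (k\<^sub>1 + 1) / k\<^sub>2 + R * (k\<^sub>1 + 1)"
  have C: "M + (k\<^sub>1 + 1) / k\<^sub>2 \<le> C" "R * (k\<^sub>1 + 1) \<le> C"
    using gains \<open>M \<ge> 0\<close> by (auto simp: C_def R_def)
  have \<beta>0: "\<beta> t i \<ge> 0" for t i by (simp add: \<beta>_def)
  have err': "\<bar>u \<bullet> err' t i\<bar> \<le> norm u * ((k\<^sub>1 + 1) * \<beta> t i)" if "i \<notin> L" "t \<ge> 0" for u t i
  proof -
    have "\<bar>u \<bullet> err' t i\<bar> \<le> \<bar>u \<bullet> (err' t i - (\<xi> t $ i - v))\<bar> + \<bar>u \<bullet> (\<xi> t $ i - v)\<bar>"
      by (simp add: inner_diff_right)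
    also have "\<dots> \<le> norm u * (k\<^sub>1 * \<bar>\<alpha> t i\<bar> + norm (\<sigma> t i)) + norm u * norm (\<xi> t $ i - v)"
      by (intro add_mono inner_err'_le that Cauchy_Schwarz_ineq2)
    also have "\<dots> = norm u * (k\<^sub>1 * \<bar>\<alpha> t i\<bar> + norm (\<sigma> t i) + norm (\<xi> t $ i - v))"
      by (simp add: distrib_left)
    also have "\<dots> \<le> norm u * ((k\<^sub>1 + 1) * \<beta> t i)"
      using gains by (intro mult_left_mono) (auto simp: \<beta>_def distrib_left distrib_right)
    finally show ?thesis .
  qed
  show ?thesis
  proof (rule eventually_le_of_bounded_primitive[OF lyapunov_deriv dissipation_nonneg lyapunov_nonneg,
        where b = "\<lambda>t. C * (\<Sum>i\<in>-L. \<beta> t i)" and y' = "\<lambda>t. - (\<Sum>i\<in>-L. r t i \<bullet> err' t i)"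
        and g = "\<lambda>t. \<Sum>i\<in>-L. (h t $ i \<bullet> err t $ i) / k\<^sub>2"
        and g' = "\<lambda>t. \<Sum>i\<in>-L. (h t $ i \<bullet> err' t i
          + (k\<^sub>2 *\<^sub>R (r t i - \<alpha> t i *\<^sub>R h t $ i + \<sigma> t i)) \<bullet> err t $ i) / k\<^sub>2"
        and M = "\<Sum>i\<in>-L. M / k\<^sub>2"])
    show "mean_small dissipation (\<lambda>t. C * (\<Sum>i\<in>-L. \<beta> t i))"
      unfolding \<beta>_def using C gains \<open>M \<ge> 0\<close>
      by (intro mean_small_cmult mean_small_sum mean_small_add mean_small_alpha mean_small_sigma
          tendsto_0_imp_mean_small aux_tendsto) (auto simp: C_def R_def)
    fix t :: real assume t: "t \<ge> 0"
    show "(potential has_real_derivative - (\<Sum>i\<in>-L. r t i \<bullet> err' t i)) (at t within {0..})"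
      by (rule potential_deriv[OF t])
    show "((\<lambda>t. \<Sum>i\<in>-L. (h t $ i \<bullet> err t $ i) / k\<^sub>2) has_real_derivative
        (\<Sum>i\<in>-L. (h t $ i \<bullet> err' t i
          + (k\<^sub>2 *\<^sub>R (r t i - \<alpha> t i *\<^sub>R h t $ i + \<sigma> t i)) \<bullet> err t $ i) / k\<^sub>2)) (at t within {0..})"
      by (intro DERIV_sum DERIV_cdivide has_real_derivative_inner heading_deriv err_deriv t) auto
    have "(\<Sum>i\<in>-L. r t i \<bullet> err' t i) \<le> (\<Sum>i\<in>-L. C * \<beta> t i)"
    proof (rule sum_mono)
      fix i assume "i \<in> -L"
      then have "r t i \<bullet> err' t i \<le> norm (r t i) * ((k\<^sub>1 + 1) * \<beta> t i)"
        using err'[of i t "r t i"] t by simp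
      also have "\<dots> \<le> R * ((k\<^sub>1 + 1) * \<beta> t i)"
        using gains \<beta>0 norm_r_le[of t i] by (intro mult_right_mono) (auto simp: R_def)
      also have "\<dots> \<le> C * \<beta> t i"
        using mult_right_mono[OF C(2) \<beta>0[of t i]] by (simp add: mult.assoc)
      finally show "r t i \<bullet> err' t i \<le> C * \<beta> t i" .
    qed
    then show "- (C * (\<Sum>i\<in>-L. \<beta> t i)) \<le> - (\<Sum>i\<in>-L. r t i \<bullet> err' t i)"
      by (simp add: sum_distrib_left)
    have "(h t $ i \<bullet> err' t i + (k\<^sub>2 *\<^sub>R (r t i - \<alpha> t i *\<^sub>R h t $ i + \<sigma> t i)) \<bullet> err t $ i) / k\<^sub>2
        \<le> r t i \<bullet> err t $ i + C * \<beta> t i" if "i \<in> -L" for i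
    proof -
      have i: "i \<notin> L" using that by simp
      have "h t $ i \<bullet> err' t i / k\<^sub>2 \<le> (k\<^sub>1 + 1) / k\<^sub>2 * \<beta> t i"
        using err'[OF i t, of "h t $ i"] norm_heading[OF i t] gains
        by (simp add: divide_right_mono)
      moreover have "(\<sigma> t i - \<alpha> t i *\<^sub>R h t $ i) \<bullet> err t $ i \<le> M * \<beta> t i"
      proof -
        have "norm (\<sigma> t i - \<alpha> t i *\<^sub>R h t $ i) \<le> \<beta> t i"
          using norm_triangle_ineq4[of "\<sigma> t i" "\<alpha> t i *\<^sub>R h t $ i"] norm_heading[OF i t]
            norm_ge_zero[of "\<xi> t $ i - v"]
          by (simp add: \<beta>_def del: norm_ge_zero)
        then have "norm (\<sigma> t i - \<alpha> t i *\<^sub>R h t $ i) * norm (err t $ i) \<le> \<beta> t i * M"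
          using Mi[OF t, of i] \<beta>0 by (intro mult_mono) auto
        then show ?thesis
          using norm_cauchy_schwarz[of "\<sigma> t i - \<alpha> t i *\<^sub>R h t $ i" "err t $ i"]
          by (simp add: mult.commute)
      qed
      moreover have "(M + (k\<^sub>1 + 1) / k\<^sub>2) * \<beta> t i \<le> C * \<beta> t i"
        using C(1) \<beta>0 by (rule mult_right_mono)
      moreover have "(h t $ i \<bullet> err' t i + (k\<^sub>2 *\<^sub>R (r t i - \<alpha> t i *\<^sub>R h t $ i + \<sigma> t i)) \<bullet> err t $ i) / k\<^sub>2
        = h t $ i \<bullet> err' t i / k\<^sub>2 + r t i \<bullet> err t $ i + (\<sigma> t i - \<alpha> t i *\<^sub>R h t $ i) \<bullet> err t $ i"
        using gains by (simp add: add_divide_distrib inner_add_left inner_diff_left)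
      ultimately show ?thesis unfolding distrib_right by linarith
    qed
    then have "(\<Sum>i\<in>-L. (h t $ i \<bullet> err' t i
          + (k\<^sub>2 *\<^sub>R (r t i - \<alpha> t i *\<^sub>R h t $ i + \<sigma> t i)) \<bullet> err t $ i) / k\<^sub>2)
        \<le> (\<Sum>i\<in>-L. r t i \<bullet> err t $ i + C * \<beta> t i)"
      by (rule sum_mono)
    also have "\<dots> = (\<Sum>i\<in>-L. r t i \<bullet> err t $ i) + C * (\<Sum>i\<in>-L. \<beta> t i)"
      by (simp add: sum.distrib sum_distrib_left)
    \<comment> \<open>Leaders have no error, so the sum extends to all agents, as in the gradient
      inequality.\<close>
    also have "(\<Sum>i\<in>-L. r t i \<bullet> err t $ i) = (\<Sum>i\<in>UNIV. r t i \<bullet> err t $ i)"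
      by (rule sum.mono_neutral_left) (auto simp: err_leader t)
    also have "\<dots> \<le> - potential t"
    proof -
      have "bearing_error E q (q + err t) i = r t i" for i
        by (simp add: r_def bearing_error_def bearing_def err_def)
      then show ?thesis
        using bearing_potential_le[OF sym, of q "q + err t"] by (simp add: potential_eq_err)
    qed
    finally show "(\<Sum>i\<in>-L. (h t $ i \<bullet> err' t i
          + (k\<^sub>2 *\<^sub>R (r t i - \<alpha> t i *\<^sub>R h t $ i + \<sigma> t i)) \<bullet> err t $ i) / k\<^sub>2)
        \<le> C * (\<Sum>i\<in>-L. \<beta> t i) - potential t"
      by simp
    have "\<bar>\<Sum>i\<in>-L. (h t $ i \<bullet> err t $ i) / k\<^sub>2\<bar> \<le> (\<Sum>i\<in>-L. \<bar>(h t $ i \<bullet> err t $ i) / k\<^sub>2\<bar>)"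
      by (rule sum_abs)
    also have "\<dots> \<le> (\<Sum>i\<in>-L. M / k\<^sub>2)"
    proof (rule sum_mono)
      fix i assume "i \<in> -L"
      then have "\<bar>h t $ i \<bullet> err t $ i\<bar> \<le> M"
        using Cauchy_Schwarz_ineq2[of "h t $ i" "err t $ i"] norm_heading[of i t] Mi[OF t, of i] t
        by simp
      then show "\<bar>(h t $ i \<bullet> err t $ i) / k\<^sub>2\<bar> \<le> M / k\<^sub>2"
        using gains by (simp add: abs_divide divide_right_mono)
    qed
    finally show "\<bar>\<Sum>i\<in>-L. (h t $ i \<bullet> err t $ i) / k\<^sub>2\<bar> \<le> (\<Sum>i\<in>-L. M / k\<^sub>2)" .
  qed (use assms in auto)
qed

text \<open>An error of norm at least \<open>\<epsilon>\<close> would keep the potential at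
  \<open>m * \<epsilon>\<close> or more, twice the bound that eventually holds.\<close>

lemma err_tendsto: "(err \<longlongrightarrow> 0) at_top"
proof (rule tendstoI)
  fix \<epsilon> :: real assume "\<epsilon> > 0"
  obtain m where m: "m > 0" "\<And>e. \<forall>i\<in>L. e $ i = 0 \<Longrightarrow> \<epsilon> \<le> norm e
      \<Longrightarrow> m * norm e \<le> bearing_potential E q (q + e)"
    using bearing_potential_coercive[OF irrefl leaders target_distinct rigid \<open>\<epsilon> > 0\<close>] by blast
  have "m * \<epsilon> / 2 > 0" using m \<open>\<epsilon> > 0\<close> by simp
  from potential_eventually_le[OF this] eventually_ge_at_top[of 0]
  show "\<forall>\<^sub>F t in at_top. dist (err t) 0 < \<epsilon>"
  proof eventually_elim
    case (elim t)
    show ?case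
    proof (rule ccontr)
      assume "\<not> ?thesis"
      then have "\<epsilon> \<le> norm (err t)" by simp
      then have "m * \<epsilon> \<le> m * norm (err t)" "m * norm (err t) \<le> potential t"
        using m elim err_leader by (auto simp: potential_eq_err)
      then show False using elim \<open>m * \<epsilon> / 2 > 0\<close> by linarith
    qed
  qed
qed

end

theorem theorem1:
  fixes E :: "('n::finite \<times> 'n) set"
    and L :: "'n set"
    and pstar p h \<xi> :: "real \<Rightarrow> real^'d::finite^'n"
    and v\<^sub>c h\<^sub>c :: "real^'d"
    and u\<^sub>c k\<^sub>1 k\<^sub>2 :: real
  assumes dim: "CARD('d) = 2 \<or> CARD('d) = 3"
    and graph: "undirected_graph E"
    and leaders: "card L \<ge> 2"
    and velocity: "norm h\<^sub>c = 1" "v\<^sub>c = u\<^sub>c *\<^sub>R h\<^sub>c"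
    and target: "\<And>i t. t \<ge> 0 \<Longrightarrow> pstar t $ i = pstar 0 $ i + t *\<^sub>R v\<^sub>c"
    and target_distinct: "\<And>i j. i \<noteq> j \<Longrightarrow> pstar 0 $ i \<noteq> pstar 0 $ j"
    and rigid: "infinitesimally_bearing_rigid (augmented_graph E L) (pstar 0)"
    and gains: "k\<^sub>1 > 0" "k\<^sub>2 > 0"
    and leader_position: "\<And>i t. i \<in> L \<Longrightarrow> t \<ge> 0 \<Longrightarrow> p t $ i = pstar t $ i"
    and leader_heading: "\<And>i t. i \<in> L \<Longrightarrow> t \<ge> 0 \<Longrightarrow> h t $ i = h\<^sub>c"
    and unit_heading: "\<And>i. i \<notin> L \<Longrightarrow> norm (h 0 $ i) = 1"
    and position_dynamics: "\<And>i t. i \<notin> L \<Longrightarrow> t \<ge> 0 \<Longrightarrow>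
          ((\<lambda>s. p s $ i) has_vector_derivative
             outer_square (h t $ i) *v
               (k\<^sub>1 *\<^sub>R bearing_error E (pstar 0) (p t) i + \<xi> t $ i))
          (at t within {0..})"
    and auxiliary_dynamics: "\<And>i t. i \<notin> L \<Longrightarrow> t \<ge> 0 \<Longrightarrow>
          ((\<lambda>s. \<xi> s $ i) has_vector_derivative
             outer_square (h t $ i) *v bearing_error E (pstar 0) (p t) i
             - orth_proj (h t $ i) *v (\<xi> t $ i))
          (at t within {0..})"
    and heading_dynamics: "\<And>i t. i \<notin> L \<Longrightarrow> t \<ge> 0 \<Longrightarrow>
          ((\<lambda>s. h s $ i) has_vector_derivative
             k\<^sub>2 *\<^sub>R (orth_proj (h t $ i) *v
               (bearing_error E (pstar 0) (p t) i + \<xi> t $ i)))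
          (at t within {0..})"
    and no_collision: "\<And>i j t. i \<noteq> j \<Longrightarrow> t \<ge> 0 \<Longrightarrow> p t $ i \<noteq> p t $ j"
  shows "((\<lambda>t. norm (p t - pstar t)) \<longlongrightarrow> 0) at_top"
proof -
  interpret bearing_only_tracking E L "pstar 0" p h \<xi> v\<^sub>c k\<^sub>1 k\<^sub>2
  proof (rule bearing_only_tracking.intro)
    show "p t $ i = pstar 0 $ i + t *\<^sub>R v\<^sub>c" if "i \<in> L" "0 \<le> t" for i t
      using leader_position[OF that] target[OF that(2)] by (rule trans)
  qed (fact graph leaders target_distinct rigid gains unit_heading position_dynamics
      auxiliary_dynamics heading_dynamics no_collision)+
  have "((\<lambda>t. norm (err t)) \<longlongrightarrow> 0) at_top"
    by (rule tendsto_norm_zero[OF err_tendsto])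
  \<comment> \<open>\<open>err\<close> is built from the explicit motion of the target, which is
    given for \<open>t \<ge> 0\<close>.\<close>
  moreover have "\<forall>\<^sub>F t in at_top. norm (err t) = norm (p t - pstar t)"
    using eventually_ge_at_top[of 0]
  proof eventually_elim
    case (elim t)
    then have "err t = p t - pstar t"
      by (simp add: err_def vec_eq_iff target[of t])
    then show ?case by simp
  qed
  ultimately show ?thesis by (rule Lim_transform_eventually)
qed

end
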